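(* Let $p$ be an odd prime, let $m\ge 1$ be an integer and let $L=2p^m$. Then the order of the matrix $\mathcal V=AB\in\mathbf{GL}_L(\mathbb F_p)$ equals $a\,p^{\mu}$ for some integer $\mu$ with $0\le\mu\le m$, where $a$ is twice the order of $-4$ in the multiplicative group $(\mathbb Z/p\mathbb Z)^\times$.
   Context: Here $\mathbb F_p=\mathbb Z/p\mathbb Z$. For an even integer $L\ge 2$, $A$ is the $L\times L$ block-diagonal matrix over $\mathbb F_p$ with $L/2$ diagonal blocks all equal to $\begin{pmatrix}1&1\\1&-1\end{pmatrix}$. $C$ is the $L\times L$ cyclic shift (permutation) matrix, $Ce_i=e_{i+1}$ with indices modulo $L$, and $B=CAC^{-1}$. (So $B$ acts by the same $2\times 2$ block on the coordinate pairs $(2,3),(4,5),\dots,(L,1)$.) Since $p$ is odd, $A$ and $B$ are invertible. The order of $\mathcal V=AB$ is the smallest integer $T\ge 1$ with $\mathcal V^T=I$ over $\mathbb F_p$. *)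

theory Defs
  imports
    "Berlekamp_Zassenhaus.Finite_Field"
    "Jordan_Normal_Form.VS_Connect"
    "HOL-Algebra.Multiplicative_Group"
begin

text \<open>
  Matrix indices start at 0, so the coordinate \<open>i\<close> of the usual numbering is row and column
  \<open>i - 1\<close> here. The definitions are over an arbitrary field; \<open>\<F>\<^sub>p\<close> is the type
  \<open>'p mod_ring\<close>, the residues modulo \<open>CARD('p)\<close>.
\<close>

definition GL :: "'a :: field itself \<Rightarrow> nat \<Rightarrow> 'a mat monoid" where
  "GL ty L = units_of (ring_mat ty L ())"

definition matA :: "nat \<Rightarrow> 'a :: field mat" where
  "matA L = diag_block_mat (replicate (L div 2) (mat_of_rows_list 2 [[1, 1], [1, - 1]]))"

text \<open>Column \<open>j\<close> of \<open>matC\<close> is \<open>e\<^sub>j\<^sub>+\<^sub>1\<close>, with indices modulo \<open>L\<close>.\<close>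

definition matC :: "nat \<Rightarrow> 'a :: field mat" where
  "matC L = mat L L (\<lambda>(i, j). if i = (j + 1) mod L then 1 else 0)"

definition matB :: "nat \<Rightarrow> 'a :: field mat" where
  "matB L = matC L * matA L * inv\<^bsub>GL TYPE('a) L\<^esub> (matC L)"

definition matV :: "nat \<Rightarrow> 'a :: field mat" where
  "matV L = matA L * matB L"

text \<open>Only meaningful if some positive power of \<open>M\<close> is the identity, for instance for
  invertible matrices over a finite field (see \<open>mat_order_eq_ord\<close>).\<close>

definition mat_order :: "'a :: field mat \<Rightarrow> nat" where
  "mat_order M = (LEAST T. T \<ge> 1 \<and> M ^\<^sub>m T = 1\<^sub>m (dim_row M))"

text \<open>The multiplicative group of a field, e.g. \<open>(\<int>/p\<int>)\<^sup>\<times>\<close> for \<open>'p mod_ring\<close>.\<close>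

definition mult_units :: "'a :: field itself \<Rightarrow> 'a monoid" where
  "mult_units ty = units_of (class_ring :: 'a ring)"

lemma group_GL: "group (GL TYPE('a :: field) L)"
proof -
  interpret ring "ring_mat TYPE('a) L ()" by (rule ring_mat)
  show ?thesis unfolding GL_def by (rule units_group)
qed

lemma group_mult_units: "group (mult_units TYPE('a :: field))"
proof -
  have "monoid (class_ring :: 'a ring)" by unfold_locales auto
  then show ?thesis unfolding mult_units_def by (rule monoid.units_group)
qed

lemma mult_units_carrier: "carrier (mult_units TYPE('a :: field)) = - {0}"
proof -
  have "field (class_ring :: 'a ring)" by (rule class_field)
  then have "Units (class_ring :: 'a ring) = carrier class_ring - {\<zero>\<^bsub>class_ring\<^esub>}"
    by (rule field.field_Units)
  then show ?thesis by (simp add: mult_units_def units_of_def Compl_eq_Diff_UNIV)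
qed

lemma two_neq_0_mod_ring:
  assumes "odd CARD('p :: prime_card)"
  shows "(2 :: 'p mod_ring) \<noteq> 0"
proof
  assume "(2 :: 'p mod_ring) = 0"
  then have "of_nat 2 = (0 :: 'p mod_ring)" by simp
  then have "CARD('p) dvd 2" using of_nat_eq_0_iff_char_dvd[of 2, where 'a = "'p mod_ring"] by simp
  then show False using prime_card[where 'a = 'p] assms
    by (metis dvd_refl primes_dvd_imp_eq two_is_prime_nat)
qed

lemma neg4_in_mult_units:
  assumes "odd CARD('p :: prime_card)"
  shows "(- 4 :: 'p mod_ring) \<in> carrier (mult_units TYPE('p mod_ring))"
proof -
  have "(- 4 :: 'p mod_ring) = - (2 * 2)" by simp
  also have "\<dots> \<noteq> 0" using two_neq_0_mod_ring[OF assms] by (metis mult_eq_0_iff neg_equal_0_iff_equal)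
  finally show ?thesis by (simp add: mult_units_carrier)
qed

lemma GL_I:
  assumes "M \<in> carrier_mat L L" "N \<in> carrier_mat L L" "M * N = 1\<^sub>m L"
  shows "(M :: 'a :: field mat) \<in> carrier (GL TYPE('a) L)"
  using assms mat_mult_left_right_inverse[OF assms]
  by (auto simp: GL_def units_of_def Units_def ring_mat_simps)

lemma diag_block_replicate_carrier:
  assumes "X \<in> carrier_mat 2 2"
  shows "diag_block_mat (replicate n X) \<in> carrier_mat (2 * n) (2 * n)"
proof (induction n)
  case (Suc n)
  then show ?case using assms by (auto simp: Let_def)
qed simp

lemma diag_block_replicate_mult:
  fixes X Y :: "'a :: field mat"
  assumes X: "X \<in> carrier_mat 2 2" and Y: "Y \<in> carrier_mat 2 2" and XY: "X * Y = 1\<^sub>m 2"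
  shows "diag_block_mat (replicate n X) * diag_block_mat (replicate n Y) = 1\<^sub>m (2 * n)"
proof (induction n)
  case 0
  show ?case by (intro eq_matI) auto
next
  case (Suc n)
  let ?X = "diag_block_mat (replicate n X)" and ?Y = "diag_block_mat (replicate n Y)"
  note c = diag_block_replicate_carrier[OF X, of n] diag_block_replicate_carrier[OF Y, of n]
  have dims: "dim_row X = 2" "dim_col X = 2" "dim_row Y = 2" "dim_col Y = 2"
    "dim_row ?X = 2 * n" "dim_col ?X = 2 * n" "dim_row ?Y = 2 * n" "dim_col ?Y = 2 * n"
    using X Y c by auto
  have "four_block_mat X (0\<^sub>m 2 (2 * n)) (0\<^sub>m (2 * n) 2) ?X *
      four_block_mat Y (0\<^sub>m 2 (2 * n)) (0\<^sub>m (2 * n) 2) ?Y =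
      four_block_mat (1\<^sub>m 2) (0\<^sub>m 2 (2 * n)) (0\<^sub>m (2 * n) 2) (1\<^sub>m (2 * n))"
    using X Y c Suc.IH XY by (subst mult_four_block_mat[OF X _ _ c(1) Y _ _ c(2)]) auto
  also have "\<dots> = 1\<^sub>m (2 * Suc n)"
    by (intro eq_matI) auto
  finally show ?case by (simp add: dims Let_def)
qed

lemma matA_GL:
  assumes "even L" "(2 :: 'a :: field) \<noteq> 0"
  shows "(matA L :: 'a mat) \<in> carrier (GL TYPE('a) L)"
proof -
  let ?X = "mat_of_rows_list 2 [[1, 1], [1, - 1]] :: 'a mat"
  let ?Y = "mat_of_rows_list 2 [[1 / 2, 1 / 2], [1 / 2, - 1 / 2]] :: 'a mat"
  have X: "?X \<in> carrier_mat 2 2" and Y: "?Y \<in> carrier_mat 2 2"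
    by (auto simp: mat_of_rows_list_def)
  have h: "(1 / 2 + 1 / 2 :: 'a) = 1" using assms(2) by (simp add: field_simps)
  have XY: "?X * ?Y = 1\<^sub>m 2"
    by (intro eq_matI)
      (auto simp: mat_of_rows_list_def scalar_prod_def less_2_cases_iff h)
  have L: "2 * (L div 2) = L" using assms(1) by simp
  show ?thesis unfolding matA_def
    by (rule GL_I)
      (use diag_block_replicate_carrier[OF X, of "L div 2"]
        diag_block_replicate_carrier[OF Y, of "L div 2"]
        diag_block_replicate_mult[OF X Y XY, of "L div 2"] in \<open>simp_all add: L\<close>)
qed

lemma matC_GL: "(matC L :: 'a :: field mat) \<in> carrier (GL TYPE('a) L)"
proof (rule GL_I)
  let ?C = "matC L :: 'a mat"
  show "?C \<in> carrier_mat L L" "transpose_mat ?C \<in> carrier_mat L L"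
    by (auto simp: matC_def)
  have "?C * transpose_mat ?C = 1\<^sub>m L"
  proof (intro eq_matI)
    fix i j assume ij: "i < dim_row (1\<^sub>m L :: 'a mat)" "j < dim_col (1\<^sub>m L :: 'a mat)"
    define k where "k = (if i = 0 then L - 1 else i - 1)"
    have i: "i < L" using ij by simp
    have k: "k < L" "(k + 1) mod L = i"
      using i by (cases "i = 0"; simp add: k_def)+
    have uniq: "l = k" if "l < L" "(l + 1) mod L = i" for l
    proof (cases "l + 1 = L")
      case True
      then have "i = 0" using that(2) by simp
      then show ?thesis using True unfolding k_def by presburger
    next
      case False
      then have "(l + 1) mod L = l + 1" using that(1) by simp
      then have "i = l + 1" using that(2) by presburger
      then show ?thesis unfolding k_def by presburger
    qed
    have "(?C * transpose_mat ?C) $$ (i, j) =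
        (\<Sum>l = 0..<L. (if i = (l + 1) mod L then 1 else 0) * (if j = (l + 1) mod L then 1 else 0))"
      using ij by (simp add: matC_def scalar_prod_def)
    also have "\<dots> = (\<Sum>l = 0..<L. if l = k then (if i = j then 1 else 0) else 0)"
    proof (rule sum.cong)
      fix l assume "l \<in> {0..<L}"
      then have "i = (l + 1) mod L \<longleftrightarrow> l = k" using uniq[of l] k(2) by force
      then show "(if i = (l + 1) mod L then 1 else 0) * (if j = (l + 1) mod L then 1 else 0) =
          (if l = k then (if i = j then 1 else 0) else (0 :: 'a))"
        by (cases "l = k") (use k(2) in auto)
    qed simp
    also have "\<dots> = (if i = j then 1 else 0)" using k(1) by simp
    finally show "(?C * transpose_mat ?C) $$ (i, j) = 1\<^sub>m L $$ (i, j)" using ij by simp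
  qed (auto simp: matC_def)
  then show "?C * transpose_mat ?C = 1\<^sub>m L" .
qed

lemma matV_GL:
  assumes "even L" "(2 :: 'a :: field) \<noteq> 0"
  shows "(matV L :: 'a mat) \<in> carrier (GL TYPE('a) L)"
proof -
  interpret group "GL TYPE('a) L" by (rule group_GL)
  have m: "x \<otimes>\<^bsub>GL TYPE('a) L\<^esub> y = x * y" for x y
    by (simp add: GL_def units_of_def ring_mat_simps)
  have A: "(matA L :: 'a mat) \<in> carrier (GL TYPE('a) L)" using assms by (rule matA_GL)
  have C: "(matC L :: 'a mat) \<in> carrier (GL TYPE('a) L)" by (rule matC_GL)
  show ?thesis unfolding matV_def matB_def m[symmetric] using A C by blast
qed

lemma mat_order_eq_ord:
  assumes "finite (UNIV :: 'a :: field set)" "(M :: 'a mat) \<in> carrier (GL TYPE('a) L)"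
  shows "mat_order M = group.ord (GL TYPE('a) L) M"
proof -
  let ?G = "GL TYPE('a) L"
  interpret group ?G by (rule group_GL)
  have M: "M \<in> carrier_mat L L"
    using assms(2) by (auto simp: GL_def units_of_def Units_def ring_mat_simps)
  have U: "M \<in> Units (ring_mat TYPE('a) L ())"
    using assms(2) by (simp add: GL_def units_of_def)
  have R: "monoid (ring_mat TYPE('a) L ())"
    using ring_mat[where 'a = 'a] by (rule ring.is_monoid)
  have pow: "M [^]\<^bsub>?G\<^esub> T = M ^\<^sub>m T" for T :: nat
    unfolding GL_def monoid.units_of_pow[OF R U] by (rule pow_mat_ring_pow[OF M, symmetric])
  have one: "\<one>\<^bsub>?G\<^esub> = 1\<^sub>m (dim_row M)"
    using M by (simp add: GL_def units_of_def ring_mat_simps)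
  have "(carrier_mat L L :: 'a mat set) \<subseteq>
      mat L L ` (({..<L} \<times> {..<L}) \<rightarrow>\<^sub>E UNIV)"
  proof
    fix X :: "'a mat" assume "X \<in> carrier_mat L L"
    then have "X = mat L L (restrict (\<lambda>ij. X $$ ij) ({..<L} \<times> {..<L}))"
      by (intro eq_matI) auto
    moreover have "restrict (\<lambda>ij. X $$ ij) ({..<L} \<times> {..<L}) \<in> ({..<L} \<times> {..<L}) \<rightarrow>\<^sub>E UNIV"
      by simp
    ultimately show "X \<in> mat L L ` (({..<L} \<times> {..<L}) \<rightarrow>\<^sub>E UNIV)"
      by (rule image_eqI[where f = "mat L L"])
  qed
  then have "finite (carrier_mat L L :: 'a mat set)"
    by (rule finite_subset) (simp add: finite_PiE assms(1))
  moreover have "carrier ?G \<subseteq> carrier_mat L L"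
    by (auto simp: GL_def units_of_def Units_def ring_mat_simps)
  ultimately have fin: "finite (carrier ?G)" by (rule rev_finite_subset)
  show ?thesis unfolding mat_order_def pow[symmetric] one[symmetric]
  proof (rule Least_equality)
    show "1 \<le> ord M \<and> M [^]\<^bsub>?G\<^esub> ord M = \<one>\<^bsub>?G\<^esub>"
      using ord_ge_1[OF fin assms(2)] pow_ord_eq_1[OF assms(2)] by simp
    fix T :: nat assume "1 \<le> T \<and> M [^]\<^bsub>?G\<^esub> T = \<one>\<^bsub>?G\<^esub>"
    then show "ord M \<le> T" using pow_eq_id[OF assms(2), of T] dvd_imp_le[of "ord M" T]
      by simp
  qed
qed

end

theory Submission
  imports Defs
begin

text \<open>
  Write \<open>q = p\<^sup>m\<close>, so that \<open>L = 2 q\<close>. Acting on \<open>L\<close>-periodic sequences, \<open>V\<close> commutes with the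
  translation \<open>s\<close> by 2 and satisfies \<open>V\<^sup>2 + 4 = (s - 1) (1 - s\<inverse>) V\<close>. The Frobenius identity turns
  the \<open>q\<close>-th power of this into \<open>V\<^sup>2\<^sup>q + 4 = 0\<close>, because \<open>(s - 1)\<^sup>q = s\<^sup>q - 1 = 0\<close>. Hence the order
  of \<open>V\<close> divides \<open>2 d q\<close>, where \<open>d\<close> is the order of \<open>- 4\<close>. Conversely, the indicator \<open>x\<close> of the
  even positions satisfies \<open>V\<^sup>2 x = - 4 x\<close>, while \<open>V x\<close> is supported on the odd positions, so
  \<open>2 d\<close> divides the order.
\<close>

section \<open>Linear operators in characteristic \<open>p\<close>\<close>

text \<open>Operators are plain functions on sequences, so that products are compositions and powers
  are iterates \<open>^^\<close>. Sums of operators have to be written pointwise.\<close>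

definition linear_op :: "(('i \<Rightarrow> 'a :: comm_ring_1) \<Rightarrow> 'i \<Rightarrow> 'a) \<Rightarrow> bool" where
  "linear_op f \<longleftrightarrow>
    (\<forall>x y. f (\<lambda>i. x i + y i) = (\<lambda>i. f x i + f y i)) \<and> (\<forall>c x. f (\<lambda>i. c * x i) = (\<lambda>i. c * f x i))"

lemma linear_op_add: "linear_op f \<Longrightarrow> f (\<lambda>i. x i + y i) = (\<lambda>i. f x i + f y i)"
  and linear_op_scale: "linear_op f \<Longrightarrow> f (\<lambda>i. c * x i) = (\<lambda>i. c * f x i)"
  by (simp_all add: linear_op_def)

lemma linear_op_zero:
  assumes "linear_op f"
  shows "f (\<lambda>i. 0) = (\<lambda>i. 0)"
  using linear_op_scale[OF assms, of 0] by simp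

lemma linear_op_comp: "linear_op f \<Longrightarrow> linear_op g \<Longrightarrow> linear_op (\<lambda>x. f (g x))"
  by (simp add: linear_op_def)

lemma linear_op_funpow:
  assumes "linear_op f"
  shows "linear_op (f ^^ n)"
proof (induction n)
  case 0
  show ?case by (simp add: linear_op_def)
next
  case (Suc n)
  then show ?case using linear_op_comp[OF assms Suc.IH] by (simp add: comp_def)
qed

text \<open>Linearity makes \<open>f\<close> commute with multiplication by \<open>c\<close>, so the
  binomial theorem applies. The induction applies the inner factor to \<open>x\<close> first, which
  is why \<open>x\<close> is arbitrary, and Pascal's rule merges the two resulting sums.\<close>

lemma funpow_add_scalar:
  assumes f: "linear_op f"
  shows "((\<lambda>x i. f x i + c * x i) ^^ n) x i =
    (\<Sum>k\<le>n. of_nat (n choose k) * c ^ (n - k) * (f ^^ k) x i)"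
proof (induction n arbitrary: x)
  case 0
  show ?case by simp
next
  case (Suc n)
  let ?t = "\<lambda>k. (f ^^ k) x i"
  have fk: "(f ^^ k) (\<lambda>i. f x i + c * x i) i = ?t (Suc k) + c * ?t k" for k
    by (simp add: linear_op_add[OF linear_op_funpow[OF f]] linear_op_scale[OF linear_op_funpow[OF f]]
        funpow_swap1)
  have "((\<lambda>x i. f x i + c * x i) ^^ Suc n) x i =
      (\<Sum>k\<le>n. of_nat (n choose k) * c ^ (n - k) * (?t (Suc k) + c * ?t k))"
    by (simp only: funpow_Suc_right comp_def Suc.IH fk)
  also have "\<dots> = (\<Sum>k\<le>n. of_nat (n choose k) * c ^ (n - k) * ?t (Suc k)) +
      (\<Sum>k\<le>n. of_nat (n choose k) * c ^ (Suc n - k) * ?t k)"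
    unfolding sum.distrib[symmetric]
    by (rule sum.cong) (simp_all add: Suc_diff_le algebra_simps del: funpow.simps)
  \<comment> \<open>The added term \<open>k = Suc n\<close> vanishes with its binomial coefficient.
    It makes the shifted sum line up with the other one.\<close>
  also have "(\<Sum>k\<le>n. of_nat (n choose k) * c ^ (Suc n - k) * ?t k) =
      (\<Sum>k\<le>Suc n. of_nat (n choose k) * c ^ (Suc n - k) * ?t k)"
    by (simp add: binomial_eq_0)
  also have "\<dots> = c ^ Suc n * ?t 0 + (\<Sum>k\<le>n. of_nat (n choose Suc k) * c ^ (n - k) * ?t (Suc k))"
    by (subst sum.atMost_Suc_shift) simp
  also have "(\<Sum>k\<le>n. of_nat (n choose k) * c ^ (n - k) * ?t (Suc k)) + \<dots> =
      c ^ Suc n * ?t 0 + (\<Sum>k\<le>n. of_nat (Suc n choose Suc k) * c ^ (n - k) * ?t (Suc k))"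
    by (simp add: sum.distrib distrib_right add_ac del: funpow.simps)
  also have "\<dots> = (\<Sum>k\<le>Suc n. of_nat (Suc n choose k) * c ^ (Suc n - k) * ?t k)"
    by (subst sum.atMost_Suc_shift) simp
  finally show ?case .
qed

text \<open>All binomial coefficients strictly between the ends are divisible by the characteristic,
  so only the terms \<open>k = 0\<close> and \<open>k = p\<close> survive.\<close>

lemma funpow_prime_add_scalar:
  fixes f :: "('i \<Rightarrow> 'a :: comm_ring_1) \<Rightarrow> 'i \<Rightarrow> 'a"
  assumes f: "linear_op f" and p: "prime CHAR('a)" "p = CHAR('a)"
  shows "((\<lambda>x i. f x i + c * x i) ^^ p) x = (\<lambda>i. (f ^^ p) x i + c ^ p * x i)"
proof
  fix i
  let ?u = "\<lambda>k. of_nat (p choose k) * c ^ (p - k) * (f ^^ k) x i"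
  have p0: "p > 0" using p prime_gt_0_nat by simp
  have "?u k = 0" if "k \<in> {..p} - {0, p}" for k
  proof -
    have "p dvd p choose k"
      by (rule dvd_choose_prime) (use that p in auto)
    then have "of_nat (p choose k) = (0 :: 'a)"
      by (simp add: of_nat_eq_0_iff_char_dvd p)
    then show ?thesis by simp
  qed
  then have "(\<Sum>k\<le>p. ?u k) = (\<Sum>k\<in>{0, p}. ?u k)"
    by (intro sum.mono_neutral_right) auto
  then show "((\<lambda>x i. f x i + c * x i) ^^ p) x i = (f ^^ p) x i + c ^ p * x i"
    using p0 by (simp add: funpow_add_scalar[OF f])
qed

text \<open>A scalar fixed by Frobenius reappears unchanged after each \<open>p\<close>-th power, so
  the prime case can be iterated with the linear operator \<open>f ^^ (p ^ m)\<close> in place of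
  \<open>f\<close>.\<close>

lemma funpow_primepow_add_scalar:
  fixes f :: "('i \<Rightarrow> 'a :: comm_ring_1) \<Rightarrow> 'i \<Rightarrow> 'a"
  assumes f: "linear_op f" and p: "prime CHAR('a)" "p = CHAR('a)" and c: "c ^ p = c"
  shows "((\<lambda>x i. f x i + c * x i) ^^ (p ^ m)) = (\<lambda>x i. (f ^^ (p ^ m)) x i + c * x i)"
proof (induction m)
  case 0
  show ?case by (simp add: fun_eq_iff)
next
  case (Suc m)
  let ?g = "\<lambda>x i. f x i + c * x i"
  have "?g ^^ (p ^ Suc m) = (?g ^^ (p ^ m)) ^^ p"
    by (simp add: funpow_mult mult.commute)
  also have "\<dots> = (\<lambda>x i. (f ^^ (p ^ m)) x i + c * x i) ^^ p"
    by (simp only: Suc.IH)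
  also have "\<dots> = (\<lambda>x i. ((f ^^ (p ^ m)) ^^ p) x i + c ^ p * x i)"
    by (rule ext) (rule funpow_prime_add_scalar[OF linear_op_funpow[OF f] p])
  also have "\<dots> = (\<lambda>x i. (f ^^ (p ^ Suc m)) x i + c * x i)"
    by (simp add: funpow_mult mult.commute c)
  finally show ?case .
qed

lemma funpow_comp_commute:
  assumes "\<And>x. f (g x) = g (f x)"
  shows "((\<lambda>x. f (g x)) ^^ n) x = (f ^^ n) ((g ^^ n) x)"
proof (induction n)
  case (Suc n)
  have "g ((f ^^ k) y) = (f ^^ k) (g y)" for k y
    by (induction k) (simp_all add: assms[symmetric])
  then show ?case using Suc by simp
qed simp

section \<open>The evolution on periodic sequences\<close>

text \<open>Sequences on all integers avoid the wrap-around modulo L. Positions start at 0, so the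
  blocks of A sit on the pairs (even, odd).\<close>

definition opA :: "(int \<Rightarrow> 'a :: comm_ring_1) \<Rightarrow> int \<Rightarrow> 'a" where
  "opA x i = (if even i then x i + x (i + 1) else x (i - 1) - x i)"

definition opB :: "(int \<Rightarrow> 'a :: comm_ring_1) \<Rightarrow> int \<Rightarrow> 'a" where
  "opB x i = (if odd i then x i + x (i + 1) else x (i - 1) - x i)"

definition opV :: "(int \<Rightarrow> 'a :: comm_ring_1) \<Rightarrow> int \<Rightarrow> 'a" where
  "opV x = opA (opB x)"

text \<open>The factor \<open>(- 1)\<close> gives this the shape "operator plus scalar" of
  \<open>funpow_primepow_add_scalar\<close>, the operator being the translation by 2.\<close>

definition forward_diff2 :: "(int \<Rightarrow> 'a :: comm_ring_1) \<Rightarrow> int \<Rightarrow> 'a" where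
  "forward_diff2 x i = x (i + 2) + (- 1) * x i"

definition backward_diff2 :: "(int \<Rightarrow> 'a :: comm_ring_1) \<Rightarrow> int \<Rightarrow> 'a" where
  "backward_diff2 x i = x i - x (i - 2)"

lemma linear_op_opV: "linear_op opV"
  unfolding linear_op_def opV_def opA_def opB_def by (auto simp: fun_eq_iff algebra_simps)

lemma linear_op_backward_diff2: "linear_op backward_diff2"
  unfolding linear_op_def backward_diff2_def by (auto simp: fun_eq_iff algebra_simps)

text \<open>The Cayley-Hamilton identity \<open>V\<^sup>2 - tr V \<cdot> V + det V = 0\<close> for the symbol of \<open>V\<close>, whose trace
  is \<open>s + s\<inverse> - 2 = (s - 1) (1 - s\<inverse>)\<close>, where \<open>s\<close> is the translation by 2.\<close>

lemma opV_quadratic: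
  "(\<lambda>i. opV (opV x) i + 4 * x i) = backward_diff2 (forward_diff2 (opV x))"
  by (rule ext)
    (simp add: opV_def opA_def opB_def forward_diff2_def backward_diff2_def algebra_simps)

lemma opV_diff2_commute:
  "opV (backward_diff2 (forward_diff2 x)) = backward_diff2 (forward_diff2 (opV x))"
  by (rule ext)
    (simp add: opV_def opA_def opB_def forward_diff2_def backward_diff2_def algebra_simps)

lemma diff2_commute: "backward_diff2 (forward_diff2 x) = forward_diff2 (backward_diff2 x)"
  by (rule ext) (simp add: forward_diff2_def backward_diff2_def algebra_simps)

lemma opV_periodic:
  assumes "\<And>i. x (i + 2 * n) = x i"
  shows "opV x (i + 2 * n) = opV x i"
proof -
  have "x (2 * n + j) = x j" for j using assms[of j] by (simp add: add.commute)
  then have "x (i + 2 * n + j) = x (i + j)" for j by (metis add.assoc add.left_commute)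
  from this[of "-1"] this[of 0] this[of 1] this[of 2] this[of "-2"] show ?thesis
    by (simp add: opV_def opA_def opB_def algebra_simps)
qed

lemma opV_funpow_periodic:
  assumes "\<And>i. x (i + 2 * n) = x i"
  shows "(opV ^^ k) x (i + 2 * n) = (opV ^^ k) x i"
proof (induction k arbitrary: i)
  case (Suc k)
  then show ?case using opV_periodic[of "(opV ^^ k) x"] by simp
qed (simp add: assms)

lemma funpow_shift2: "((\<lambda>x i. x (i + 2 :: int)) ^^ n) x = (\<lambda>i. x (i + 2 * int n))"
  by (induction n arbitrary: x) (simp_all add: funpow_Suc_right algebra_simps del: funpow.simps)

text \<open>Additivity of Frobenius on 1 + 1 fixes 2, hence also its square.\<close>

lemma four_pow_char:
  assumes "prime CHAR('a)"
  shows "(4 :: 'a :: comm_ring_1) ^ CHAR('a) = 4"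
proof -
  have "(1 + 1 :: 'a) ^ CHAR('a) = 1 + 1"
    using freshmans_dream[OF assms refl, of 1 1] by simp
  then have "(2 * 2 :: 'a) ^ CHAR('a) = 2 * 2" by (simp only: power_mult_distrib one_add_one)
  then show ?thesis by simp
qed

lemma opV_primepow:
  fixes x :: "int \<Rightarrow> 'a :: comm_ring_1"
  assumes p: "prime CHAR('a)" "p = CHAR('a)" "odd p"
    and x: "\<And>i. x (i + 2 * int (p ^ m)) = x i"
  shows "(opV ^^ (2 * p ^ m)) x = (\<lambda>i. - 4 * x i)"
proof -
  let ?q = "p ^ m"
  let ?N = "\<lambda>x :: int \<Rightarrow> 'a. backward_diff2 (forward_diff2 x)"
  have S: "linear_op (\<lambda>(x :: int \<Rightarrow> 'a) i. x (i + 2))"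
    by (simp add: linear_op_def)
  have V2: "linear_op (\<lambda>x :: int \<Rightarrow> 'a. opV (opV x))"
    by (rule linear_op_comp[OF linear_op_opV linear_op_opV])
  \<comment> \<open>Oddness of \<open>p\<close> enters here: it makes the scalar -1 a fixed point of
    Frobenius.\<close>
  have D: "(forward_diff2 ^^ ?q) y = (\<lambda>i. y (i + 2 * int ?q) + (- 1) * y i)"
    for y :: "int \<Rightarrow> 'a"
    using funpow_primepow_add_scalar[OF S p(1,2), of "- 1" m] p(3)
    by (simp add: forward_diff2_def[abs_def] funpow_shift2 fun_eq_iff)
  have "((\<lambda>x i. opV (opV x) i + 4 * x i) ^^ ?q) x = (?N ^^ ?q) ((opV ^^ ?q) x)"
    unfolding opV_quadratic by (rule funpow_comp_commute) (rule opV_diff2_commute[symmetric])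
  also have "\<dots> = (backward_diff2 ^^ ?q) ((forward_diff2 ^^ ?q) ((opV ^^ ?q) x))"
    by (rule funpow_comp_commute) (rule diff2_commute)
  \<comment> \<open>The iterates of \<open>opV\<close> keep the period \<open>2 * ?q\<close>, so the
    difference over that distance is zero.\<close>
  also have "(forward_diff2 ^^ ?q) ((opV ^^ ?q) x) = (\<lambda>i. 0)"
    using opV_funpow_periodic[of x "int ?q", OF x] by (simp only: D) simp
  also have "(backward_diff2 ^^ ?q) (\<lambda>i. 0) = (\<lambda>i. 0 :: 'a)"
    by (rule linear_op_zero[OF linear_op_funpow[OF linear_op_backward_diff2]])
  \<comment> \<open>The left-hand side is expanded by Frobenius too, now for the operator V squared
    and the scalar 4.\<close>
  also have "((\<lambda>x i. opV (opV x) i + 4 * x i) ^^ ?q) x =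
      (\<lambda>i. ((\<lambda>x. opV (opV x)) ^^ ?q) x i + 4 * x i)"
    using funpow_primepow_add_scalar[OF V2 p(1,2), of 4 m] four_pow_char[OF p(1)] p(2) by simp
  also have "(\<lambda>x. opV (opV x)) ^^ ?q = (opV ^^ (2 * ?q) :: (int \<Rightarrow> 'a) \<Rightarrow> _)"
    by (simp only: funpow_mult[symmetric]) (simp add: numeral_2_eq_2 comp_def)
  finally show ?thesis by (simp add: fun_eq_iff eq_neg_iff_add_eq_0)
qed

text \<open>The inner \<open>k\<close> applications turn \<open>x\<close> into a multiple of itself,
  and linearity pulls the scalar out of the rest. \<open>P\<close> stands for periodicity in the
  upper bound and for a single eigenvector in the lower bound.\<close>

lemma funpow_scalar_power:
  assumes f: "linear_op f" and k: "\<And>x. P x \<Longrightarrow> (f ^^ k) x = (\<lambda>i. c * x i)" and x: "P x"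
  shows "(f ^^ (k * n)) x = (\<lambda>i. c ^ n * x i)"
proof (induction n)
  case (Suc n)
  have "(f ^^ (k * Suc n)) x = (f ^^ (k * n)) ((f ^^ k) x)"
    by (simp add: add.commute[of k] funpow_add)
  then show ?case
    using Suc by (simp add: k[OF x] linear_op_scale[OF linear_op_funpow[OF f]] mult_ac)
qed simp

section \<open>An eigenvector of V squared for the lower bound\<close>

definition even_indicator :: "int \<Rightarrow> 'a :: comm_ring_1" where
  "even_indicator i = (if even i then 1 else 0)"

lemma opV_even_indicator: "opV even_indicator = (\<lambda>i. if even i then 0 else - 2)"
  by (rule ext) (simp add: opV_def opA_def opB_def even_indicator_def)

text \<open>The sequence is invariant under translation by 2, and so is its image under
  \<open>opV\<close>; hence the right-hand side of \<open>opV_quadratic\<close> vanishes on it. Here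
  the value is computed directly.\<close>

lemma opV2_even_indicator: "(opV ^^ 2) even_indicator = (\<lambda>i. - 4 * even_indicator i)"
  by (rule ext)
    (simp add: numeral_2_eq_2 opV_even_indicator, simp add: opV_def opA_def opB_def even_indicator_def)

lemma opV_funpow_even_indicator:
  "(opV ^^ (2 * n)) even_indicator = (\<lambda>i. (- 4) ^ n * even_indicator i)"
  by (rule funpow_scalar_power[OF linear_op_opV, where P = "\<lambda>x. x = even_indicator"])
    (simp_all add: opV2_even_indicator)

lemma opV_funpow_even_indicator_eq:
  assumes "(opV ^^ T) even_indicator = (even_indicator :: int \<Rightarrow> 'a :: comm_ring_1)"
  shows "\<exists>n. T = 2 * n \<and> (- 4 :: 'a) ^ n = 1"
proof (cases "even T")
  case True
  then obtain n where n: "T = 2 * n" by blast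
  then have "(- 4 :: 'a) ^ n * even_indicator 0 = even_indicator 0"
    using assms opV_funpow_even_indicator[of n] by metis
  then show ?thesis using n by (auto simp: even_indicator_def)
next
  case False
  then obtain n where n: "T = 2 * n + 1" by (rule oddE)
  \<comment> \<open>Position 0 refutes odd \<open>T\<close>: one extra step moves the support to the
    odd positions, whereas the indicator is 1 at 0.\<close>
  have "(opV ^^ T) even_indicator 0 = opV (\<lambda>i. (- 4 :: 'a) ^ n * even_indicator i) 0"
    by (simp add: n opV_funpow_even_indicator)
  also have "\<dots> = (- 4) ^ n * opV even_indicator 0"
    by (simp add: linear_op_scale[OF linear_op_opV])
  also have "\<dots> = 0" by (simp add: opV_even_indicator)
  finally show ?thesis by (simp add: assms even_indicator_def)
qed

section \<open>Periodic extension of vectors\<close>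

definition periodic_ext :: "'a vec \<Rightarrow> int \<Rightarrow> 'a" where
  "periodic_ext v i = v $ nat (i mod int (dim_vec v))"

lemma periodic_ext_of_nat: "k < dim_vec v \<Longrightarrow> periodic_ext v (int k) = v $ k"
  by (simp add: periodic_ext_def)

lemma periodic_ext_cong:
  "i mod int (dim_vec v) = j mod int (dim_vec v) \<Longrightarrow> periodic_ext v i = periodic_ext v j"
  by (simp add: periodic_ext_def)

lemma periodic_ext_inject:
  assumes "dim_vec v = dim_vec w" "periodic_ext v = periodic_ext w"
  shows "v = w"
  using assms by (intro eq_vecI) (auto simp flip: periodic_ext_of_nat)

text \<open>Removing the top left block lowers both indices by 2, which preserves their residues
  modulo 2 and whether their halves agree.\<close>

lemma diag_block_replicate_index:
  assumes X: "X \<in> carrier_mat 2 2" and "i < 2 * n" "j < 2 * n"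
  shows "diag_block_mat (replicate n X) $$ (i, j) =
    (if i div 2 = j div 2 then X $$ (i mod 2, j mod 2) else 0)"
  using assms(2,3)
proof (induction n arbitrary: i j)
  case (Suc n)
  have dims: "dim_row X = 2" "dim_col X = 2"
    "dim_row (diag_block_mat (replicate n X)) = 2 * n"
    "dim_col (diag_block_mat (replicate n X)) = 2 * n"
    using X diag_block_replicate_carrier[OF X, of n] by auto
  have d: "\<exists>k'. k = k' + 2" if "\<not> k < 2" for k :: nat
    using that by presburger
  show ?case
  proof (cases "i < 2 \<or> j < 2")
    case True
    then have "i div 2 = j div 2 \<longleftrightarrow> i < 2 \<and> j < 2" by presburger
    moreover have "diag_block_mat (replicate (Suc n) X) $$ (i, j) =
        (if i < 2 \<and> j < 2 then X $$ (i, j) else 0)"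
      using True Suc.prems by (simp add: dims Let_def) linarith
    ultimately show ?thesis by simp
  next
    case False
    then obtain i' j' where "i = i' + 2" "j = j' + 2" using d by meson
    then show ?thesis using Suc.prems Suc.IH[of i' j'] by (simp add: dims Let_def)
  qed
qed simp

lemma matA_carrier: "even L \<Longrightarrow> (matA L :: 'a :: field mat) \<in> carrier_mat L L"
  using diag_block_replicate_carrier[of "mat_of_rows_list 2 [[1, 1], [1, - 1]] :: 'a mat" "L div 2"]
  unfolding matA_def by (force simp: mat_of_rows_list_def)

lemma matA_mult_vec_index:
  assumes L: "even L" and v: "v \<in> carrier_vec L" and k: "k < L"
  shows "(matA L *\<^sub>v v) $ k =
    (if even k then v $ k + v $ (k + 1) else v $ (k - 1) - v $ k :: 'a :: field)"
proof -
  let ?X = "mat_of_rows_list 2 [[1, 1], [1, - 1]] :: 'a mat"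
  \<comment> \<open>The block containing row \<open>k\<close> occupies the columns \<open>b\<close>
    and \<open>b + 1\<close>; row \<open>k\<close> is zero elsewhere.\<close>
  define b where "b = 2 * (k div 2)"
  have b: "b + 1 < L" using L k unfolding b_def by presburger
  have bk: "if even k then b = k else b = k - 1 \<and> b + 1 = k" unfolding b_def by presburger
  have X: "?X \<in> carrier_mat 2 2" by (auto simp: mat_of_rows_list_def)
  have "(matA L *\<^sub>v v) $ k = (\<Sum>j<L. matA L $$ (k, j) * v $ j)"
    using matA_carrier[OF L, where 'a = 'a] v k by (simp add: scalar_prod_def atLeast0LessThan)
  also have "\<dots> = (\<Sum>j\<in>{b, b + 1}. matA L $$ (k, j) * v $ j)"
  proof (rule sum.mono_neutral_right)
    show "\<forall>j\<in>{..<L} - {b, b + 1}. matA L $$ (k, j) * v $ j = 0"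
    proof
      fix j assume j: "j \<in> {..<L} - {b, b + 1}"
      then have "k div 2 \<noteq> j div 2" unfolding b_def by auto
      then show "matA L $$ (k, j) * v $ j = 0"
        using j L k diag_block_replicate_index[OF X, of k "L div 2" j] by (simp add: matA_def)
    qed
  qed (use b in auto)
  also have "\<dots> = ?X $$ (k mod 2, 0) * v $ b + ?X $$ (k mod 2, 1) * v $ (b + 1)"
    using L k b diag_block_replicate_index[OF X, of k "L div 2" b]
      diag_block_replicate_index[OF X, of k "L div 2" "b + 1"]
    by (simp add: matA_def b_def)
  also have "\<dots> = (if even k then v $ k + v $ (k + 1) else v $ (k - 1) - v $ k)"
  proof (cases "even k")
    case True
    then have "k mod 2 = 0" "b = k" using bk by auto
    then show ?thesis using True by (simp add: mat_of_rows_list_def)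
  next
    case False
    then have "k mod 2 = 1" "b = k - 1" "b + 1 = k" using bk by (auto simp: odd_iff_mod_2_eq_one)
    then show ?thesis using False by (simp add: mat_of_rows_list_def)
  qed
  finally show ?thesis .
qed

lemma periodic_ext_matA:
  assumes L: "even L" "L > 0" and v: "v \<in> carrier_vec L"
  shows "periodic_ext (matA L *\<^sub>v v) = opA (periodic_ext v :: int \<Rightarrow> 'a :: field)"
proof
  fix i
  define k where "k = nat (i mod int L)"
  have k: "k < L" "int k = i mod int L" using L by (auto simp: k_def nat_less_iff)
  \<comment> \<open>Reduction modulo an even L preserves parity, so the case distinction in
    \<open>opA\<close> matches the one for the vector.\<close>
  have par: "even k = even i"
  proof -
    have "even (int k) = even i" unfolding k(2) using L(1)
      by (metis dvd_mod_iff even_of_nat)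
    then show ?thesis by simp
  qed
  have dims: "dim_vec v = L" "dim_row (matA L :: 'a mat) = L"
    using v matA_carrier[OF L(1), where 'a = 'a] by auto
  have "periodic_ext v (int k) = periodic_ext v i"
    by (rule periodic_ext_cong) (simp add: dims k)
  moreover have "periodic_ext v (int k + 1) = periodic_ext v (i + 1)"
    by (rule periodic_ext_cong) (simp add: dims k mod_simps)
  moreover have "periodic_ext v (int k - 1) = periodic_ext v (i - 1)"
    by (rule periodic_ext_cong) (simp add: dims k mod_simps)
  moreover have "periodic_ext v (int k) = v $ k"
    using k(1) dims(1) by (intro periodic_ext_of_nat) simp
  \<comment> \<open>For even \<open>k\<close> and even \<open>L\<close> the index
    \<open>k + 1\<close> is still below \<open>L\<close>: no block of A wraps around.\<close>
  moreover have "periodic_ext v (int k + 1) = v $ (k + 1)" if "even k"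
    using that k dims L(1) periodic_ext_of_nat[of "k + 1" v]
    by (metis Suc_eq_plus1 Suc_lessI even_Suc of_nat_Suc add.commute)
  moreover have "periodic_ext v (int k - 1) = v $ (k - 1)" if "odd k"
    using that k dims periodic_ext_of_nat[of "k - 1" v] odd_pos[OF that] by (simp add: of_nat_diff)
  moreover have "periodic_ext (matA L *\<^sub>v v) i = (matA L *\<^sub>v v) $ k"
    by (simp add: periodic_ext_def dims k_def del: index_mult_mat_vec)
  ultimately show "periodic_ext (matA L *\<^sub>v v) i = opA (periodic_ext v) i"
    using matA_mult_vec_index[OF L(1) v k(1)] par by (simp add: opA_def)
qed

lemma matC_carrier: "matC L \<in> carrier_mat L L"
  by (simp add: matC_def)

lemma periodic_ext_matC:
  assumes L: "L > 0" and v: "v \<in> carrier_vec L"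
  shows "periodic_ext (matC L *\<^sub>v v) i = (periodic_ext v (i - 1) :: 'a :: field)"
proof -
  define k where "k = nat (i mod int L)"
  define l where "l = nat ((i - 1) mod int L)"
  have k: "k < L" "int k = i mod int L" and l: "l < L" "int l = (i - 1) mod int L"
    using L by (auto simp: k_def l_def nat_less_iff)
  have dims: "dim_vec v = L" "dim_row (matC L :: 'a mat) = L"
    using v by (auto simp: matC_def)
  \<comment> \<open>Row \<open>k\<close> of the shift matrix has its single 1 in column
    \<open>l\<close>, the cyclic predecessor of \<open>k\<close>.\<close>
  have kl: "k = (j + 1) mod L \<longleftrightarrow> j = l" if "j < L" for j
  proof -
    have "k = (j + 1) mod L \<longleftrightarrow> i mod int L = (int j + 1) mod int L"
      unfolding k(2)[symmetric] by (metis int_ops(2) of_nat_add of_nat_eq_iff of_nat_mod)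
    also have "\<dots> \<longleftrightarrow> (i - 1) mod int L = int j mod int L"
      by (simp add: mod_eq_dvd_iff algebra_simps)
    also have "\<dots> \<longleftrightarrow> j = l" using that l(2) by auto
    finally show ?thesis .
  qed
  have "periodic_ext (matC L *\<^sub>v v) i = (matC L *\<^sub>v v) $ k"
    by (simp add: periodic_ext_def dims k_def del: index_mult_mat_vec)
  also have "\<dots> = (\<Sum>j<L. (if k = (j + 1) mod L then 1 else 0) * v $ j)"
    using v k by (simp add: matC_def scalar_prod_def atLeast0LessThan)
  also have "\<dots> = (\<Sum>j<L. if j = l then v $ j else 0)"
    by (intro sum.cong) (use kl in auto)
  also have "\<dots> = v $ l" using l by simp
  also have "\<dots> = periodic_ext v (i - 1)" by (simp add: periodic_ext_def dims l_def)
  finally show ?thesis .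
qed

lemma carrier_GL_carrier_mat: "M \<in> carrier (GL TYPE('a :: field) L) \<Longrightarrow> M \<in> carrier_mat L L"
  by (auto simp: GL_def units_of_def Units_def ring_mat_simps)

lemma matB_carrier: "even L \<Longrightarrow> (matB L :: 'a :: field mat) \<in> carrier_mat L L"
  unfolding matB_def
  by (rule mult_carrier_mat[OF mult_carrier_mat[OF matC_carrier matA_carrier]
      carrier_GL_carrier_mat[OF group.inv_closed[OF group_GL matC_GL]]])

text \<open>Conjugation by the shift evaluates \<open>opA\<close> one place to the left on a
  sequence moved the opposite way. The net effect is to exchange the roles of even and odd
  positions, which is \<open>opB\<close>.\<close>

lemma periodic_ext_matB:
  assumes L: "even L" "L > 0" and v: "v \<in> carrier_vec L"
  shows "periodic_ext (matB L *\<^sub>v v) = opB (periodic_ext v :: int \<Rightarrow> 'a :: field)"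
proof
  fix i
  let ?D = "inv\<^bsub>GL TYPE('a) L\<^esub> (matC L)"
  interpret group "GL TYPE('a) L" by (rule group_GL)
  have D: "?D \<in> carrier_mat L L"
    by (rule carrier_GL_carrier_mat) (rule inv_closed[OF matC_GL])
  have A: "(matA L :: 'a mat) \<in> carrier_mat L L" by (rule matA_carrier[OF L(1)])
  have C: "(matC L :: 'a mat) \<in> carrier_mat L L" by (rule matC_carrier)
  \<comment> \<open>The inverse is known only abstractly; its action is read off from that of
    \<open>matC\<close> through this identity.\<close>
  have "matC L * ?D = 1\<^sub>m L"
    using r_inv[OF matC_GL] by (simp add: GL_def units_of_def ring_mat_simps)
  then have "matC L *\<^sub>v (?D *\<^sub>v v) = v"
    using assoc_mult_mat_vec[OF C D v] v by simp
  then have Dv: "periodic_ext (?D *\<^sub>v v) j = periodic_ext v (j + 1)" for j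
    using periodic_ext_matC[OF L(2), of "?D *\<^sub>v v" "j + 1"] D v by simp
  have "periodic_ext (matB L *\<^sub>v v) i = periodic_ext (matC L *\<^sub>v (matA L *\<^sub>v (?D *\<^sub>v v))) i"
    unfolding matB_def using assoc_mult_mat_vec[OF mult_carrier_mat[OF C A] D v]
      assoc_mult_mat_vec[OF C A, of "?D *\<^sub>v v"] D v by simp
  also have "\<dots> = periodic_ext (matA L *\<^sub>v (?D *\<^sub>v v)) (i - 1)"
    by (rule periodic_ext_matC[OF L(2)]) (use A D v in auto)
  also have "\<dots> = opA (periodic_ext (?D *\<^sub>v v)) (i - 1)"
    using periodic_ext_matA[OF L, of "?D *\<^sub>v v"] D v by simp
  also have "\<dots> = opB (periodic_ext v) i"
    by (simp add: opA_def opB_def Dv)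
  finally show "periodic_ext (matB L *\<^sub>v v) i = opB (periodic_ext v) i" .
qed

lemma matV_carrier: "even L \<Longrightarrow> (matV L :: 'a :: field mat) \<in> carrier_mat L L"
  unfolding matV_def by (rule mult_carrier_mat[OF matA_carrier matB_carrier])

text \<open>This carries statements about iterates of \<open>opV\<close> over to matrix powers. The
  vector is arbitrary because the induction applies one factor to it first.\<close>

lemma periodic_ext_matV_pow:
  assumes L: "even L" "L > 0" and v: "v \<in> carrier_vec L"
  shows "periodic_ext (matV L ^\<^sub>m T *\<^sub>v v) = (opV ^^ T) (periodic_ext v :: int \<Rightarrow> 'a :: field)"
  using v
proof (induction T arbitrary: v)
  case 0
  then show ?case using matV_carrier[OF L(1), where 'a = 'a] by simp
next
  case (Suc T)
  note V = matV_carrier[OF L(1), where 'a = 'a]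
  have Vv: "matV L *\<^sub>v v \<in> carrier_vec L" using V Suc.prems by simp
  have "matV L *\<^sub>v v = matA L *\<^sub>v (matB L *\<^sub>v v)"
    unfolding matV_def
    by (rule assoc_mult_mat_vec[OF matA_carrier[OF L(1)] matB_carrier[OF L(1)] Suc.prems])
  then have "periodic_ext (matV L *\<^sub>v v) = opV (periodic_ext v)"
    using periodic_ext_matA[OF L, of "matB L *\<^sub>v v"] periodic_ext_matB[OF L Suc.prems]
      matB_carrier[OF L(1), where 'a = 'a] Suc.prems
    by (simp add: opV_def)
  moreover have "matV L ^\<^sub>m Suc T *\<^sub>v v = matV L ^\<^sub>m T *\<^sub>v (matV L *\<^sub>v v)"
    using assoc_mult_mat_vec[OF pow_carrier_mat[OF V] V Suc.prems] by simp
  ultimately show ?case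
    using Suc.IH[OF Vv] by (simp add: funpow_swap1)
qed

section \<open>Determination of the order\<close>

lemma mat_eq_one_if_mult_vec:
  assumes M: "M \<in> carrier_mat n n" and "\<And>v. v \<in> carrier_vec n \<Longrightarrow> M *\<^sub>v v = v"
  shows "M = (1\<^sub>m n :: 'a :: semiring_1 mat)"
proof (rule eq_matI)
  fix i j assume ij: "i < dim_row (1\<^sub>m n :: 'a mat)" "j < dim_col (1\<^sub>m n :: 'a mat)"
  have "M $$ (i, j) = (M *\<^sub>v unit_vec n j) $ i"
    using M ij by simp
  then show "M $$ (i, j) = 1\<^sub>m n $$ (i, j)" using assms(2)[of "unit_vec n j"] ij by simp
qed (use M in auto)

theorem corollaryA1:
  fixes p m L :: nat
  assumes "prime p" "odd p" "CARD('p :: prime_card) = p"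
    and "m \<ge> 1" "L = 2 * p ^ m"
  shows "\<exists>\<mu>\<le>m. mat_order (matV L :: 'p mod_ring mat)
    = 2 * group.ord (mult_units TYPE('p mod_ring)) (- 4) * p ^ \<mu>"
proof -
  let ?V = "matV L :: 'p mod_ring mat" and ?GL = "GL TYPE('p mod_ring) L" and ?U = "mult_units TYPE('p mod_ring)"
  interpret G: group ?GL by (rule group_GL)
  interpret U: group ?U by (rule group_mult_units)
  have L: "even L" "L > 0" using assms by (auto simp: prime_gt_0_nat)
  have V: "?V \<in> carrier_mat L L" by (rule matV_carrier[OF L(1)])
  have two: "(2 :: 'p mod_ring) \<noteq> 0" using assms(2,3) by (intro two_neq_0_mod_ring) simp
  have VG: "?V \<in> carrier ?GL" by (rule matV_GL[OF L(1) two])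
  have ordV: "mat_order ?V = G.ord ?V"
    by (rule mat_order_eq_ord[OF _ VG]) simp
  have powV: "?V [^]\<^bsub>?GL\<^esub> T = \<one>\<^bsub>?GL\<^esub> \<longleftrightarrow> ?V ^\<^sub>m T = 1\<^sub>m L" for T :: nat
  proof -
    have U: "?V \<in> Units (ring_mat TYPE('p mod_ring) L ())"
      using VG by (simp add: GL_def units_of_def)
    have R: "monoid (ring_mat TYPE('p mod_ring) L ())"
      using ring_mat[where 'a = "'p mod_ring"] by (rule ring.is_monoid)
    show ?thesis
      unfolding GL_def monoid.units_of_pow[OF R U] pow_mat_ring_pow[OF V, of _ "()"]
      by (simp add: units_of_def ring_mat_simps)
  qed
  have four: "(- 4 :: 'p mod_ring) \<in> carrier ?U" using assms(2,3) by (intro neg4_in_mult_units) simp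
  have pow4: "(- 4 :: 'p mod_ring) ^ n = 1 \<longleftrightarrow> U.ord (- 4) dvd n" for n
  proof -
    have "x [^]\<^bsub>?U\<^esub> n = x ^ n" for x :: "'p mod_ring"
      by (induction n) (simp_all add: mult_units_def units_of_def nat_pow_def mult_ac)
    then show ?thesis using U.pow_eq_id[OF four, of n]
      by (simp add: mult_units_def units_of_def)
  qed
  let ?d = "U.ord (- 4 :: 'p mod_ring)"
  have char: "prime CHAR('p mod_ring)" "p = CHAR('p mod_ring)" using assms by simp_all
  \<comment> \<open>Every extended vector has period \<open>L = 2 * p ^ m\<close>, so
    \<open>opV_primepow\<close> applies; its scalar -4 becomes 1 after \<open>?d\<close>
    repetitions.\<close>
  have "?V ^\<^sub>m (2 * p ^ m * ?d) = 1\<^sub>m L"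
  proof (rule mat_eq_one_if_mult_vec)
    show VT: "?V ^\<^sub>m (2 * p ^ m * ?d) \<in> carrier_mat L L" using V by simp
    fix v :: "'p mod_ring vec" assume v: "v \<in> carrier_vec L"
    have per: "periodic_ext v (i + 2 * int (p ^ m)) = periodic_ext v i" for i
      using v assms(5) by (intro periodic_ext_cong) simp
    have "(opV ^^ (2 * p ^ m * ?d)) (periodic_ext v) = (\<lambda>i. (- 4) ^ ?d * periodic_ext v i)"
    proof (rule funpow_scalar_power[OF linear_op_opV])
      fix x :: "int \<Rightarrow> 'p mod_ring"
      assume "\<forall>i. x (i + 2 * int (p ^ m)) = x i"
      then show "(opV ^^ (2 * p ^ m)) x = (\<lambda>i. - 4 * x i)"
        by (intro opV_primepow[OF char assms(2)]) blast
    qed (use per in blast)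
    also have "\<dots> = periodic_ext v" using pow4[of ?d] by simp
    finally show "?V ^\<^sub>m (2 * p ^ m * ?d) *\<^sub>v v = v"
      using VT v by (intro periodic_ext_inject) (auto simp: periodic_ext_matV_pow[OF L v])
  qed
  then have upper: "G.ord ?V dvd 2 * ?d * p ^ m"
    using powV G.pow_eq_id[OF VG] by (metis mult.assoc mult.commute)
  \<comment> \<open>Since \<open>L\<close> is even, the alternating pattern closes up and the
    periodic extension of \<open>w\<close> is \<open>even_indicator\<close>.\<close>
  define w :: "'p mod_ring vec" where "w = vec L (\<lambda>i. if even i then 1 else 0)"
  have w: "w \<in> carrier_vec L" by (simp add: w_def)
  have ext_w: "periodic_ext w = even_indicator"
  proof
    fix i
    have "even (nat (i mod int L)) = even i"
      using L by (simp add: even_nat_iff dvd_mod_iff)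
    moreover have "nat (i mod int L) < L" using L by (simp add: nat_less_iff)
    ultimately show "periodic_ext w i = even_indicator i"
      by (simp add: periodic_ext_def w_def even_indicator_def)
  qed
  have "?V ^\<^sub>m G.ord ?V = 1\<^sub>m L" using powV G.pow_ord_eq_1[OF VG] by blast
  then have "(opV ^^ G.ord ?V) even_indicator = (even_indicator :: int \<Rightarrow> 'p mod_ring)"
    using periodic_ext_matV_pow[OF L w, of "G.ord ?V"] w by (simp add: ext_w)
  then obtain n where n: "G.ord ?V = 2 * n" "(- 4 :: 'p mod_ring) ^ n = 1"
    using opV_funpow_even_indicator_eq by blast
  then obtain t where "n = ?d * t" using pow4 by (blast elim: dvdE)
  then have t: "G.ord ?V = 2 * ?d * t" using n(1) by simp
  \<comment> \<open>Positivity allows cancelling \<open>2 * ?d\<close> from the divisibility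
    \<open>upper\<close>, which leaves a divisor of a prime power.\<close>
  have "?d > 0" using U.ord_ge_1[OF _ four] by simp
  then have "t dvd p ^ m" using upper t by simp
  then obtain \<mu> where "\<mu> \<le> m" "t = p ^ \<mu>"
    using divides_primepow_nat[OF assms(1)] by blast
  then show ?thesis using t ordV by auto
qed

end
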